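(* Let $R$ be a commutative semiring and $v:R\to M$ an m-valuation. Then $v$ has an initial cover, and the poset $\mathrm{Cov}(v)$ is a complete lattice.
   Context: All semirings are commutative with $0$ and $1$. A semiring $M$ is bipotent if $a+b\in\{a,b\}$ for all $a,b\in M$; it is totally ordered by $a\le b\iff a+b=b$ (so $a+b=\max(a,b)$). A supertropical semiring is a semiring $U$ such that, with $e=e_U:=1+1$: (1) $1+1=1+1+1+1$; (2) $a+a=b+b$ implies $a+b=a+a$; (3) $a+a\ne b+b$ implies $a+b\in\{a,b\}$ (for all $a,b\in U$). Then $e$ is idempotent and $eU$ (the ghost ideal) is a bipotent semiring with unit element $e$. An m-valuation on $R$ is a map $v:R\to M$ into a bipotent semiring $M\neq\{0\}$ with $v(0)=0$, $v(1)=1$, $v(xy)=v(x)v(y)$, $v(x+y)\le v(x)+v(y)=\max(v(x),v(y))$. A supervaluation on $R$ is a map $\varphi:R\to U$ into a supertropical semiring $U$ with $\varphi(0)=0$, $\varphi(1)=1$, $\varphi(ab)=\varphi(a)\varphi(b)$ and $e\varphi(a+b)\le e\varphi(a)+e\varphi(b)$ for all $a,b\in R$. Then $e\varphi:R\to eU$, $a\mapsto e\varphi(a)$, is an m-valuation, and $\varphi$ is said to cover it. A cover of $v:R\to M$ is a supervaluation $\varphi:R\to U$ with $eU=M$ and $e\varphi=v$. A supervaluation $\varphi:R\to U$ dominates a supervaluation $\psi:R\to V$ (written $\varphi\ge\psi$) if for all $a,b\in R$: (D1) $\varphi(a)=\varphi(b)\Rightarrow\psi(a)=\psi(b)$; (D2)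 $e\varphi(a)\le e\varphi(b)\Rightarrow e\psi(a)\le e\psi(b)$; (D3) $\varphi(a)\in eU\Rightarrow\psi(a)\in eV$. Two covers of $v$ are equivalent if each dominates the other. $\mathrm{Cov}(v)$ is the set of equivalence classes $[\varphi]$ of covers of $v$, partially ordered by $[\varphi_1]\ge[\varphi_2]$ iff $\varphi_1$ dominates $\varphi_2$. An initial cover of $v$ is a cover $\varphi$ of $v$ which dominates every other cover $\psi$ of $v$. *)

theory Defs
  imports "HOL-Algebra.QuotRing" "HOL-Algebra.Complete_Lattice"
begin

section \<open>Bipotent and supertropical semirings\<close>

locale csemiring = semiring R + comm_monoid R for R (structure)

locale bipotent_semiring = csemiring M for M (structure) +
  assumes bipotent: "\<lbrakk>a \<in> carrier M; b \<in> carrier M\<rbrakk> \<Longrightarrow> a \<oplus> b \<in> {a, b}"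

definition sle :: "('a, 'm) ring_scheme \<Rightarrow> 'a \<Rightarrow> 'a \<Rightarrow> bool" (infixl \<open>\<preceq>\<index>\<close> 50)
  where "a \<preceq>\<^bsub>M\<^esub> b \<longleftrightarrow> a \<oplus>\<^bsub>M\<^esub> b = b"

definition ghost_unit :: "('a, 'm) ring_scheme \<Rightarrow> 'a" (\<open>\<e>\<index>\<close>)
  where "\<e>\<^bsub>U\<^esub> = \<one>\<^bsub>U\<^esub> \<oplus>\<^bsub>U\<^esub> \<one>\<^bsub>U\<^esub>"

locale supertropical_semiring = csemiring U for U (structure) +
  assumes one_four: "\<one> \<oplus> \<one> = \<one> \<oplus> \<one> \<oplus> \<one> \<oplus> \<one>"
    and ghost_eq: "\<lbrakk>a \<in> carrier U; b \<in> carrier U; a \<oplus> a = b \<oplus> b\<rbrakk> \<Longrightarrow> a \<oplus> b = a \<oplus> a"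
    and ghost_neq: "\<lbrakk>a \<in> carrier U; b \<in> carrier U; a \<oplus> a \<noteq> b \<oplus> b\<rbrakk> \<Longrightarrow> a \<oplus> b \<in> {a, b}"

definition ghosts :: "('a, 'm) ring_scheme \<Rightarrow> 'a set"
  where "ghosts U = (\<lambda>x. \<e>\<^bsub>U\<^esub> \<otimes>\<^bsub>U\<^esub> x) ` carrier U"

definition ghost_semiring :: "('a, 'm) ring_scheme \<Rightarrow> ('a, 'm) ring_scheme"
  where "ghost_semiring U = U\<lparr>carrier := ghosts U, one := \<e>\<^bsub>U\<^esub>\<rparr>"


section \<open>Valuations, supervaluations, dominance\<close>

locale m_valuation = R?: csemiring R + M?: bipotent_semiring M
  for R :: "('r, 'a) ring_scheme" (structure) and M :: "('m, 'b) ring_scheme" (structure) +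
  fixes v :: "'r \<Rightarrow> 'm"
  assumes nontrivial: "carrier M \<noteq> {\<zero>\<^bsub>M\<^esub>}"
    and val_closed: "v \<in> carrier R \<rightarrow> carrier M"
    and val_zero: "v \<zero>\<^bsub>R\<^esub> = \<zero>\<^bsub>M\<^esub>"
    and val_one: "v \<one>\<^bsub>R\<^esub> = \<one>\<^bsub>M\<^esub>"
    and val_mult: "\<lbrakk>x \<in> carrier R; y \<in> carrier R\<rbrakk> \<Longrightarrow> v (x \<otimes>\<^bsub>R\<^esub> y) = v x \<otimes>\<^bsub>M\<^esub> v y"
    and val_add: "\<lbrakk>x \<in> carrier R; y \<in> carrier R\<rbrakk> \<Longrightarrow> v (x \<oplus>\<^bsub>R\<^esub> y) \<preceq>\<^bsub>M\<^esub> v x \<oplus>\<^bsub>M\<^esub> v y"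

locale supervaluation = R?: csemiring R + U?: supertropical_semiring U
  for R :: "('r, 'a) ring_scheme" (structure) and U :: "('u, 'b) ring_scheme" (structure) +
  fixes \<phi> :: "'r \<Rightarrow> 'u"
  assumes sv_closed: "\<phi> \<in> carrier R \<rightarrow> carrier U"
    and sv_zero: "\<phi> \<zero>\<^bsub>R\<^esub> = \<zero>\<^bsub>U\<^esub>"
    and sv_one: "\<phi> \<one>\<^bsub>R\<^esub> = \<one>\<^bsub>U\<^esub>"
    and sv_mult: "\<lbrakk>a \<in> carrier R; b \<in> carrier R\<rbrakk> \<Longrightarrow> \<phi> (a \<otimes>\<^bsub>R\<^esub> b) = \<phi> a \<otimes>\<^bsub>U\<^esub> \<phi> b"
    and sv_add: "\<lbrakk>a \<in> carrier R; b \<in> carrier R\<rbrakk> \<Longrightarrow>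
      \<e>\<^bsub>U\<^esub> \<otimes>\<^bsub>U\<^esub> \<phi> (a \<oplus>\<^bsub>R\<^esub> b) \<preceq>\<^bsub>U\<^esub> \<e>\<^bsub>U\<^esub> \<otimes>\<^bsub>U\<^esub> \<phi> a \<oplus>\<^bsub>U\<^esub> \<e>\<^bsub>U\<^esub> \<otimes>\<^bsub>U\<^esub> \<phi> b"

text \<open>A map into a semiring is represented by the pair of its target and the underlying function,
  of which only the values on \<open>carrier R\<close> matter. The two maps compared by \<open>dominates\<close> may have
  targets in different HOL types.\<close>

type_synonym ('r, 'u) sval = "'u ring \<times> ('r \<Rightarrow> 'u)"

definition dominates :: "('r, 'a) ring_scheme \<Rightarrow> ('r, 'u) sval \<Rightarrow> ('r, 'w) sval \<Rightarrow> bool"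
  where "dominates R p q \<longleftrightarrow> (case (p, q) of ((U, \<phi>), (V, \<psi>)) \<Rightarrow>
    (\<forall>a\<in>carrier R. \<forall>b\<in>carrier R.
      (\<phi> a = \<phi> b \<longrightarrow> \<psi> a = \<psi> b) \<and>
      (\<e>\<^bsub>U\<^esub> \<otimes>\<^bsub>U\<^esub> \<phi> a \<preceq>\<^bsub>U\<^esub> \<e>\<^bsub>U\<^esub> \<otimes>\<^bsub>U\<^esub> \<phi> b \<longrightarrow> \<e>\<^bsub>V\<^esub> \<otimes>\<^bsub>V\<^esub> \<psi> a \<preceq>\<^bsub>V\<^esub> \<e>\<^bsub>V\<^esub> \<otimes>\<^bsub>V\<^esub> \<psi> b) \<and>
      (\<phi> a \<in> ghosts U \<longrightarrow> \<psi> a \<in> ghosts V)))"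


section \<open>Covers\<close>

text \<open>The condition \<open>eU = M\<close> is read up to an isomorphism \<open>j\<close> identifying \<open>M\<close> with the ghost
  semiring of \<open>U\<close>, because \<open>M\<close> and \<open>U\<close> live in different HOL types. The equation \<open>e\<phi> = v\<close>
  refers to the same identification.\<close>

definition is_cover ::
    "('r, 'a) ring_scheme \<Rightarrow> ('m, 'b) ring_scheme \<Rightarrow> ('r \<Rightarrow> 'm) \<Rightarrow> ('r, 'u) sval \<Rightarrow> bool"
  where "is_cover R M v p \<longleftrightarrow> (case p of (U, \<phi>) \<Rightarrow>
    supervaluation R U \<phi> \<and>
    (\<exists>j \<in> ring_iso M (ghost_semiring U). \<forall>a\<in>carrier R. \<e>\<^bsub>U\<^esub> \<otimes>\<^bsub>U\<^esub> \<phi> a = j (v a)))"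

text \<open>HOL cannot quantify over all types inside a formula, so the competing covers range over the
  targets in one type \<open>'w\<close>, which is a parameter. In a theorem with \<open>'w\<close> free this covers all
  targets; the choice of \<open>p\<close> then depends on \<open>'w\<close> at most up to equivalence when \<open>p\<close> is also initial
  with respect to its own target type.\<close>

definition initial_cover ::
    "'w itself \<Rightarrow> ('r, 'a) ring_scheme \<Rightarrow> ('m, 'b) ring_scheme \<Rightarrow> ('r \<Rightarrow> 'm) \<Rightarrow> ('r, 'u) sval \<Rightarrow> bool"
  where "initial_cover (_ :: 'w itself) R M v p \<longleftrightarrow>
    is_cover R M v p \<and> (\<forall>q :: ('r, 'w) sval. is_cover R M v q \<longrightarrow> dominates R p q)"

text \<open>The poset \<open>Cov(v)\<close> is built from the covers with target in the type \<open>'r + 'm\<close>. By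
  \<open>cover_equiv_sum_type\<close> below, every cover with target in any type is equivalent to one of these,
  so no equivalence class is lost. Note that \<open>le x y\<close> says that \<open>y\<close> dominates \<open>x\<close>.\<close>

definition cover_equiv ::
    "('r, 'a) ring_scheme \<Rightarrow> ('m, 'b) ring_scheme \<Rightarrow> ('r \<Rightarrow> 'm) \<Rightarrow> ('r, 'r + 'm) sval rel"
  where "cover_equiv R M v =
    {(p, q). is_cover R M v p \<and> is_cover R M v q \<and> dominates R p q \<and> dominates R q p}"

definition Cov ::
    "('r, 'a) ring_scheme \<Rightarrow> ('m, 'b) ring_scheme \<Rightarrow> ('r \<Rightarrow> 'm) \<Rightarrow> ('r, 'r + 'm) sval set gorder"
  where "Cov R M v =
    \<lparr>carrier = {p. is_cover R M v p} // cover_equiv R M v,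
     eq = (=),
     le = (\<lambda>x y. \<exists>p\<in>y. \<exists>q\<in>x. dominates R p q)\<rparr>"


section \<open>Basic facts\<close>

lemma dominates_refl: "dominates R p p"
  by (auto simp: dominates_def split: prod.splits)

lemma dominates_trans:
  assumes "dominates R p q" "dominates R q s"
  shows "dominates R p s"
proof -
  obtain U \<phi> V \<psi> W \<chi> where [simp]: "p = (U, \<phi>)" "q = (V, \<psi>)" "s = (W, \<chi>)"
    by (metis surj_pair)
  show ?thesis
    using assms unfolding dominates_def by (simp (no_asm_use)) meson
qed

lemma equiv_cover_equiv: "equiv {p. is_cover R M v p} (cover_equiv R M v)"
proof (rule equivI)
  show "cover_equiv R M v \<subseteq> {p. is_cover R M v p} \<times> {p. is_cover R M v p}"
    by (auto simp: cover_equiv_def)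
  show "refl_on {p. is_cover R M v p} (cover_equiv R M v)"
    by (simp add: cover_equiv_def refl_on_def dominates_refl)
  show "sym (cover_equiv R M v)"
    by (simp add: cover_equiv_def sym_def)
  show "trans (cover_equiv R M v)"
    unfolding cover_equiv_def trans_def by (blast intro: dominates_trans)
qed

lemma Cov_le_iff:
  assumes "is_cover R M v p" "is_cover R M v q"
  shows "le (Cov R M v) (cover_equiv R M v `` {p}) (cover_equiv R M v `` {q}) \<longleftrightarrow> dominates R q p"
  using assms unfolding Cov_def cover_equiv_def
  by (simp del: split_paired_Ex) (blast intro: dominates_refl dominates_trans)

lemma csemiringI:
  fixes R (structure)
  assumes "\<And>x y. x \<in> carrier R \<Longrightarrow> y \<in> carrier R \<Longrightarrow> x \<oplus> y \<in> carrier R"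
    and "\<zero> \<in> carrier R"
    and "\<And>x y z. x \<in> carrier R \<Longrightarrow> y \<in> carrier R \<Longrightarrow> z \<in> carrier R \<Longrightarrow> (x \<oplus> y) \<oplus> z = x \<oplus> (y \<oplus> z)"
    and "\<And>x. x \<in> carrier R \<Longrightarrow> \<zero> \<oplus> x = x"
    and "\<And>x y. x \<in> carrier R \<Longrightarrow> y \<in> carrier R \<Longrightarrow> x \<oplus> y = y \<oplus> x"
    and "\<And>x y. x \<in> carrier R \<Longrightarrow> y \<in> carrier R \<Longrightarrow> x \<otimes> y \<in> carrier R"
    and "\<one> \<in> carrier R"
    and "\<And>x y z. x \<in> carrier R \<Longrightarrow> y \<in> carrier R \<Longrightarrow> z \<in> carrier R \<Longrightarrow> (x \<otimes> y) \<otimes> z = x \<otimes> (y \<otimes> z)"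
    and "\<And>x. x \<in> carrier R \<Longrightarrow> \<one> \<otimes> x = x"
    and comm: "\<And>x y. x \<in> carrier R \<Longrightarrow> y \<in> carrier R \<Longrightarrow> x \<otimes> y = y \<otimes> x"
    and dist: "\<And>x y z. x \<in> carrier R \<Longrightarrow> y \<in> carrier R \<Longrightarrow> z \<in> carrier R \<Longrightarrow> (x \<oplus> y) \<otimes> z = x \<otimes> z \<oplus> y \<otimes> z"
    and null: "\<And>x. x \<in> carrier R \<Longrightarrow> \<zero> \<otimes> x = \<zero>"
  shows "csemiring R"
proof -
  interpret A: abelian_monoid R
    by (rule abelian_monoidI) (use assms in auto)
  interpret C: comm_monoid R
    by (rule comm_monoidI) (use assms in auto)
  show ?thesis
  proof
    fix x y z assume "x \<in> carrier R" "y \<in> carrier R" "z \<in> carrier R"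
    then show "(x \<oplus> y) \<otimes> z = x \<otimes> z \<oplus> y \<otimes> z" "z \<otimes> (x \<oplus> y) = z \<otimes> x \<oplus> z \<otimes> y"
      using dist comm A.a_closed by metis+
  next
    fix x assume "x \<in> carrier R"
    then show "\<zero> \<otimes> x = \<zero>" "x \<otimes> \<zero> = \<zero>"
      using null comm A.zero_closed by metis+
  qed
qed

context supertropical_semiring
begin

lemma e_closed [simp]: "\<e> \<in> carrier U"
  by (simp add: ghost_unit_def)

lemma e_mult: "x \<in> carrier U \<Longrightarrow> \<e> \<otimes> x = x \<oplus> x"
  by (simp add: ghost_unit_def l_distr)

lemma e_idem: "\<e> \<otimes> \<e> = \<e>"
  unfolding e_mult[OF e_closed] unfolding ghost_unit_def
  using one_four by (simp add: a_assoc)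

lemma e_e_mult: "x \<in> carrier U \<Longrightarrow> \<e> \<otimes> (\<e> \<otimes> x) = \<e> \<otimes> x"
  by (metis e_closed e_idem m_assoc)

lemma ghosts_closed: "x \<in> ghosts U \<Longrightarrow> x \<in> carrier U"
  by (auto simp: ghosts_def)

lemma ghosts_iff: "x \<in> ghosts U \<longleftrightarrow> x \<in> carrier U \<and> \<e> \<otimes> x = x"
  by (auto simp: ghosts_def e_e_mult intro: rev_image_eqI)

lemma e_mult_ghost: "x \<in> carrier U \<Longrightarrow> \<e> \<otimes> x \<in> ghosts U"
  by (auto simp: ghosts_def)

lemma ghosts_add: "\<lbrakk>x \<in> ghosts U; y \<in> ghosts U\<rbrakk> \<Longrightarrow> x \<oplus> y \<in> ghosts U"
  by (auto simp: ghosts_iff r_distr)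

lemma ghosts_mult: "\<lbrakk>x \<in> ghosts U; y \<in> carrier U\<rbrakk> \<Longrightarrow> x \<otimes> y \<in> ghosts U"
  by (auto simp: ghosts_iff m_assoc[symmetric])

lemma ghosts_bipotent: "\<lbrakk>x \<in> ghosts U; y \<in> ghosts U\<rbrakk> \<Longrightarrow> x \<oplus> y \<in> {x, y}"
  by (metis e_mult ghost_eq ghost_neq ghosts_iff insertI1)

lemma bipotent_ghost_semiring: "bipotent_semiring (ghost_semiring U)"
proof -
  have [simp]: "carrier (ghost_semiring U) = ghosts U" "\<one>\<^bsub>ghost_semiring U\<^esub> = \<e>"
    "\<zero>\<^bsub>ghost_semiring U\<^esub> = \<zero>" "add (ghost_semiring U) = add U" "mult (ghost_semiring U) = mult U"
    by (simp_all add: ghost_semiring_def)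
  show ?thesis
  proof (intro bipotent_semiring.intro bipotent_semiring_axioms.intro csemiringI)
    fix x y z
    assume x: "x \<in> carrier (ghost_semiring U)" and y: "y \<in> carrier (ghost_semiring U)"
    then show "x \<oplus>\<^bsub>ghost_semiring U\<^esub> y \<in> {x, y}"
      using ghosts_bipotent by simp
    show "x \<oplus>\<^bsub>ghost_semiring U\<^esub> y = y \<oplus>\<^bsub>ghost_semiring U\<^esub> x"
      "x \<otimes>\<^bsub>ghost_semiring U\<^esub> y = y \<otimes>\<^bsub>ghost_semiring U\<^esub> x"
      using x y ghosts_closed by (simp_all add: a_comm m_comm)
    assume z: "z \<in> carrier (ghost_semiring U)"
    show "(x \<oplus>\<^bsub>ghost_semiring U\<^esub> y) \<otimes>\<^bsub>ghost_semiring U\<^esub> z =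
      x \<otimes>\<^bsub>ghost_semiring U\<^esub> z \<oplus>\<^bsub>ghost_semiring U\<^esub> y \<otimes>\<^bsub>ghost_semiring U\<^esub> z"
      using x y z ghosts_closed by (simp add: l_distr)
  qed (auto simp: ghosts_add ghosts_mult ghosts_closed a_assoc m_assoc ghosts_iff e_idem,
      auto simp: ghosts_iff m_assoc[symmetric] r_distr)
qed

end

lemma (in supervaluation) m_valuation_ghost:
  assumes nt: "carrier U \<noteq> {\<zero>\<^bsub>U\<^esub>}"
  shows "m_valuation R (ghost_semiring U) (\<lambda>a. \<e>\<^bsub>U\<^esub> \<otimes>\<^bsub>U\<^esub> \<phi> a)"
proof -
  have c: "\<phi> a \<in> carrier U" if "a \<in> carrier R" for a
    using sv_closed that by auto
  have nt': "ghosts U \<noteq> {\<zero>\<^bsub>U\<^esub>}"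
  proof
    assume g: "ghosts U = {\<zero>\<^bsub>U\<^esub>}"
    have "x = \<zero>\<^bsub>U\<^esub>" if x: "x \<in> carrier U" for x
    proof -
      have "x \<oplus>\<^bsub>U\<^esub> x = \<zero>\<^bsub>U\<^esub>"
        using U.e_mult_ghost[OF x] g x by (simp add: U.e_mult)
      then show ?thesis
        using U.ghost_eq[OF x U.zero_closed] x by simp
    qed
    then show False using nt by auto
  qed
  have m: "\<e>\<^bsub>U\<^esub> \<otimes>\<^bsub>U\<^esub> (x \<otimes>\<^bsub>U\<^esub> y) = \<e>\<^bsub>U\<^esub> \<otimes>\<^bsub>U\<^esub> x \<otimes>\<^bsub>U\<^esub> (\<e>\<^bsub>U\<^esub> \<otimes>\<^bsub>U\<^esub> y)"
    if "x \<in> carrier U" "y \<in> carrier U" for x y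
    using that by (metis U.e_closed U.e_idem U.m_assoc U.m_closed U.m_lcomm)
  show ?thesis
    by (intro m_valuation.intro R.csemiring_axioms U.bipotent_ghost_semiring m_valuation_axioms.intro)
      (use nt' c m sv_add in \<open>auto simp: ghost_semiring_def U.e_mult_ghost sv_zero sv_one sv_mult sle_def\<close>)
qed

lemma supertropical_transfer:
  fixes U :: "('u, 'm) ring_scheme" and h :: "'u \<Rightarrow> 'w"
  assumes st: "supertropical_semiring U"
    and W: "W \<subseteq> carrier U" "\<zero>\<^bsub>U\<^esub> \<in> W" "\<one>\<^bsub>U\<^esub> \<in> W"
    and cl: "\<And>x y. x \<in> W \<Longrightarrow> y \<in> W \<Longrightarrow> x \<oplus>\<^bsub>U\<^esub> y \<in> W" "\<And>x y. x \<in> W \<Longrightarrow> y \<in> W \<Longrightarrow> x \<otimes>\<^bsub>U\<^esub> y \<in> W"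
    and V: "carrier V = h ` W" "\<zero>\<^bsub>V\<^esub> = h \<zero>\<^bsub>U\<^esub>" "\<one>\<^bsub>V\<^esub> = h \<one>\<^bsub>U\<^esub>"
    and ad: "\<And>x y. x \<in> W \<Longrightarrow> y \<in> W \<Longrightarrow> h x \<oplus>\<^bsub>V\<^esub> h y = h (x \<oplus>\<^bsub>U\<^esub> y)"
    and mu: "\<And>x y. x \<in> W \<Longrightarrow> y \<in> W \<Longrightarrow> h x \<otimes>\<^bsub>V\<^esub> h y = h (x \<otimes>\<^bsub>U\<^esub> y)"
    and inj: "inj_on h W"
  shows "supertropical_semiring V"
proof -
  interpret U: supertropical_semiring U by (rule st)
  have c: "\<And>x. x \<in> W \<Longrightarrow> x \<in> carrier U" using W by auto
  note ij = inj_on_eq_iff[OF inj]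
  have V_cs: "csemiring V"
  proof (rule csemiringI)
    fix a b d assume "a \<in> carrier V" "b \<in> carrier V" "d \<in> carrier V"
    then obtain x y z where [simp]: "a = h x" "b = h y" "d = h z" and [simp]: "x \<in> W" "y \<in> W" "z \<in> W"
      by (auto simp: V)
    note [simp] = c[OF \<open>x \<in> W\<close>] c[OF \<open>y \<in> W\<close>] c[OF \<open>z \<in> W\<close>]
    show "(a \<oplus>\<^bsub>V\<^esub> b) \<oplus>\<^bsub>V\<^esub> d = a \<oplus>\<^bsub>V\<^esub> (b \<oplus>\<^bsub>V\<^esub> d)"
      "(a \<otimes>\<^bsub>V\<^esub> b) \<otimes>\<^bsub>V\<^esub> d = a \<otimes>\<^bsub>V\<^esub> (b \<otimes>\<^bsub>V\<^esub> d)"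
      by (simp_all add: ad mu cl U.a_assoc U.m_assoc)
    show "(a \<oplus>\<^bsub>V\<^esub> b) \<otimes>\<^bsub>V\<^esub> d = a \<otimes>\<^bsub>V\<^esub> d \<oplus>\<^bsub>V\<^esub> b \<otimes>\<^bsub>V\<^esub> d"
      by (simp add: ad mu cl U.l_distr)
  next
    fix a b assume "a \<in> carrier V" "b \<in> carrier V"
    then obtain x y where [simp]: "a = h x" "b = h y" and [simp]: "x \<in> W" "y \<in> W"
      by (auto simp: V)
    note [simp] = c[OF \<open>x \<in> W\<close>] c[OF \<open>y \<in> W\<close>]
    show "a \<oplus>\<^bsub>V\<^esub> b \<in> carrier V" "a \<otimes>\<^bsub>V\<^esub> b \<in> carrier V"
      by (simp_all add: V(1) ad mu cl)
    show "a \<oplus>\<^bsub>V\<^esub> b = b \<oplus>\<^bsub>V\<^esub> a" "a \<otimes>\<^bsub>V\<^esub> b = b \<otimes>\<^bsub>V\<^esub> a"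
      by (simp_all add: ad mu U.a_comm[of x y] U.m_comm[of x y])
  next
    fix a assume "a \<in> carrier V"
    then obtain x where [simp]: "a = h x" and [simp]: "x \<in> W"
      by (auto simp: V)
    show "\<zero>\<^bsub>V\<^esub> \<oplus>\<^bsub>V\<^esub> a = a" "\<one>\<^bsub>V\<^esub> \<otimes>\<^bsub>V\<^esub> a = a" "\<zero>\<^bsub>V\<^esub> \<otimes>\<^bsub>V\<^esub> a = \<zero>\<^bsub>V\<^esub>"
      by (simp_all add: V(2,3) ad mu W(2,3) c)
  qed (simp_all add: V W(2,3))
  show ?thesis
  proof (intro supertropical_semiring.intro V_cs supertropical_semiring_axioms.intro)
    have one: "\<one>\<^bsub>U\<^esub> \<oplus>\<^bsub>U\<^esub> \<one>\<^bsub>U\<^esub> \<in> W" "\<one>\<^bsub>U\<^esub> \<oplus>\<^bsub>U\<^esub> \<one>\<^bsub>U\<^esub> \<oplus>\<^bsub>U\<^esub> \<one>\<^bsub>U\<^esub> \<in> W"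
      by (intro cl W)+
    show "\<one>\<^bsub>V\<^esub> \<oplus>\<^bsub>V\<^esub> \<one>\<^bsub>V\<^esub> = \<one>\<^bsub>V\<^esub> \<oplus>\<^bsub>V\<^esub> \<one>\<^bsub>V\<^esub> \<oplus>\<^bsub>V\<^esub> \<one>\<^bsub>V\<^esub> \<oplus>\<^bsub>V\<^esub> \<one>\<^bsub>V\<^esub>"
      by (simp only: V(3) ad W one U.one_four[symmetric])
  next
    fix a b assume "a \<in> carrier V" "b \<in> carrier V"
    then obtain x y where xy: "a = h x" "b = h y" and W': "x \<in> W" "y \<in> W"
      by (auto simp: V)
    have ad': "a \<oplus>\<^bsub>V\<^esub> a = h (x \<oplus>\<^bsub>U\<^esub> x)" "b \<oplus>\<^bsub>V\<^esub> b = h (y \<oplus>\<^bsub>U\<^esub> y)" "a \<oplus>\<^bsub>V\<^esub> b = h (x \<oplus>\<^bsub>U\<^esub> y)"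
      using xy W' by (simp_all add: ad)
    have iff: "a \<oplus>\<^bsub>V\<^esub> a = b \<oplus>\<^bsub>V\<^esub> b \<longleftrightarrow> x \<oplus>\<^bsub>U\<^esub> x = y \<oplus>\<^bsub>U\<^esub> y"
      unfolding ad' by (rule ij) (intro cl W')+
    show "a \<oplus>\<^bsub>V\<^esub> b = a \<oplus>\<^bsub>V\<^esub> a" if "a \<oplus>\<^bsub>V\<^esub> a = b \<oplus>\<^bsub>V\<^esub> b"
      unfolding ad' using that[unfolded iff] U.ghost_eq[OF c c, OF W'] by simp
    show "a \<oplus>\<^bsub>V\<^esub> b \<in> {a, b}" if "a \<oplus>\<^bsub>V\<^esub> a \<noteq> b \<oplus>\<^bsub>V\<^esub> b"
      unfolding ad' unfolding xy using that[unfolded iff] U.ghost_neq[OF c c, OF W'] by auto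
  qed
qed

text \<open>Only the subsemiring \<open>W = eU \<union> \<phi>(R)\<close> of the target matters for a cover; it is copied into
  \<open>'r + 'm\<close> by sending ghosts to \<open>'m\<close> and any other \<open>\<phi>(a)\<close> to a chosen preimage in \<open>'r\<close>.\<close>

theorem cover_equiv_sum_type:
  fixes R :: "('r, 'a) ring_scheme" and M :: "('m, 'b) ring_scheme" and p :: "('r, 'u) sval"
  assumes cov: "is_cover R M v p"
  shows "\<exists>q :: ('r, 'r + 'm) sval. is_cover R M v q \<and> dominates R p q \<and> dominates R q p"
proof -
  obtain U \<phi> where p: "p = (U, \<phi>)" by (cases p)
  obtain j where sv: "supervaluation R U \<phi>" and j: "j \<in> ring_iso M (ghost_semiring U)"
    and jv: "\<And>a. a \<in> carrier R \<Longrightarrow> \<e>\<^bsub>U\<^esub> \<otimes>\<^bsub>U\<^esub> \<phi> a = j (v a)"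
    using cov by (auto simp: is_cover_def p)
  interpret supervaluation R U \<phi> by (rule sv)
  have bij: "bij_betw j (carrier M) (ghosts U)"
    using ring_iso_memE(5)[OF j] by (simp add: ghost_semiring_def)
  define W where "W = ghosts U \<union> \<phi> ` carrier R"
  define h :: "'u \<Rightarrow> 'r + 'm" where "h x = (if x \<in> ghosts U then Inr (inv_into (carrier M) j x)
    else Inl (inv_into (carrier R) \<phi> x))" for x
  have inj: "inj_on h W"
  proof (rule inj_onI)
    fix x y assume "x \<in> W" "y \<in> W" "h x = h y"
    then show "x = y"
      using bij unfolding h_def W_def bij_betw_def
      by (auto split: if_splits dest: inv_into_injective)
  qed
  have Wc: "W \<subseteq> carrier U"
    using sv_closed U.ghosts_closed by (auto simp: W_def)
  then have c: "\<And>x. x \<in> W \<Longrightarrow> x \<in> carrier U" by auto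
  have W0: "\<zero>\<^bsub>U\<^esub> \<in> W" "\<one>\<^bsub>U\<^esub> \<in> W"
    using imageI[OF R.zero_closed, of \<phi>] imageI[OF R.one_closed, of \<phi>]
    by (simp_all add: W_def sv_zero sv_one)
  have Wm: "x \<otimes>\<^bsub>U\<^esub> y \<in> W" if "x \<in> W" "y \<in> W" for x y
  proof (cases "x \<in> ghosts U \<or> y \<in> ghosts U")
    case True
    then have "x \<otimes>\<^bsub>U\<^esub> y \<in> ghosts U"
      using U.ghosts_mult[of x y] U.ghosts_mult[of y x] U.m_comm[of x y] c that by auto
    then show ?thesis by (simp add: W_def)
  next
    case False
    then obtain a b where "a \<in> carrier R" "b \<in> carrier R" "x = \<phi> a" "y = \<phi> b"
      using \<open>x \<in> W\<close> \<open>y \<in> W\<close> by (auto simp: W_def)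
    then have "x \<otimes>\<^bsub>U\<^esub> y = \<phi> (a \<otimes>\<^bsub>R\<^esub> b)" "a \<otimes>\<^bsub>R\<^esub> b \<in> carrier R"
      by (simp_all add: sv_mult)
    then show ?thesis by (simp add: W_def)
  qed
  have Wa: "x \<oplus>\<^bsub>U\<^esub> y \<in> W" if "x \<in> W" "y \<in> W" for x y
  proof (cases "x \<oplus>\<^bsub>U\<^esub> x = y \<oplus>\<^bsub>U\<^esub> y")
    case True
    then have "x \<oplus>\<^bsub>U\<^esub> y = \<e>\<^bsub>U\<^esub> \<otimes>\<^bsub>U\<^esub> x"
      using U.ghost_eq[OF c c, OF that True] U.e_mult[OF c, OF that(1)] by simp
    then show ?thesis using U.e_mult_ghost[OF c, OF that(1)] by (simp add: W_def)
  next
    case False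
    then show ?thesis using U.ghost_neq[OF c c, OF that False] that by auto
  qed
  define g where "g = inv_into W h"
  have gh: "g (h x) = x" if "x \<in> W" for x
    using that inj by (simp add: g_def)
  define V :: "('r + 'm) ring" where "V = \<lparr>carrier = h ` W, mult = (\<lambda>x y. h (g x \<otimes>\<^bsub>U\<^esub> g y)),
    one = h \<one>\<^bsub>U\<^esub>, zero = h \<zero>\<^bsub>U\<^esub>, add = (\<lambda>x y. h (g x \<oplus>\<^bsub>U\<^esub> g y))\<rparr>"
  have V: "carrier V = h ` W" "\<zero>\<^bsub>V\<^esub> = h \<zero>\<^bsub>U\<^esub>" "\<one>\<^bsub>V\<^esub> = h \<one>\<^bsub>U\<^esub>"
    "\<And>x y. x \<in> W \<Longrightarrow> y \<in> W \<Longrightarrow> h x \<oplus>\<^bsub>V\<^esub> h y = h (x \<oplus>\<^bsub>U\<^esub> y)"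
    "\<And>x y. x \<in> W \<Longrightarrow> y \<in> W \<Longrightarrow> h x \<otimes>\<^bsub>V\<^esub> h y = h (x \<otimes>\<^bsub>U\<^esub> y)"
    by (auto simp: V_def gh)
  have stV: "supertropical_semiring V"
    by (rule supertropical_transfer[where h = h and W = W, OF U.supertropical_semiring_axioms])
      (use Wc W0 Wa Wm V inj in auto)
  interpret V: supertropical_semiring V by (rule stV)
  note ij = inj_on_eq_iff[OF inj]
  have \<phi>W: "\<phi> a \<in> W" if "a \<in> carrier R" for a
    using that by (simp add: W_def)
  have gW: "x \<in> W" if "x \<in> ghosts U" for x
    using that by (simp add: W_def)
  have eW: "\<e>\<^bsub>U\<^esub> \<in> W"
    by (simp add: ghost_unit_def Wa W0)
  have eV: "\<e>\<^bsub>V\<^esub> = h \<e>\<^bsub>U\<^esub>"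
    by (simp add: ghost_unit_def V W0)
  have em: "\<e>\<^bsub>V\<^esub> \<otimes>\<^bsub>V\<^esub> h x = h (\<e>\<^bsub>U\<^esub> \<otimes>\<^bsub>U\<^esub> x)" if "x \<in> W" for x
    using that by (simp add: eV V eW)
  have gV: "h x \<in> ghosts V \<longleftrightarrow> x \<in> ghosts U" if "x \<in> W" for x
    using that c by (simp add: V.ghosts_iff U.ghosts_iff V em ij Wm eW)
  have gV': "ghosts V = h ` ghosts U"
    using gV gW V.ghosts_closed[unfolded V(1)] by blast
  have sl: "h x \<preceq>\<^bsub>V\<^esub> h y \<longleftrightarrow> x \<preceq>\<^bsub>U\<^esub> y" if "x \<in> W" "y \<in> W" for x y
    using that by (simp add: sle_def V ij Wa)
  have svV: "supervaluation R V (\<lambda>a. h (\<phi> a))"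
    by (intro supervaluation.intro R.csemiring_axioms stV supervaluation_axioms.intro)
      (auto simp: sv_zero sv_one sv_mult V \<phi>W em sl Wm Wa eW intro: sv_add)
  have jW: "j m \<in> ghosts U" if "m \<in> carrier M" for m
    using bij that by (auto simp: bij_betw_def)
  have "(\<lambda>m. h (j m)) \<in> ring_iso M (ghost_semiring V)"
  proof (rule ring_iso_memI)
    have "bij_betw (h \<circ> j) (carrier M) (ghosts V)"
      by (rule bij_betw_trans[OF bij]) (use inj gV' gW in \<open>auto simp: bij_betw_def inj_on_def\<close>)
    then show "bij_betw (\<lambda>m. h (j m)) (carrier M) (carrier (ghost_semiring V))"
      by (simp add: ghost_semiring_def comp_def)
  qed (use ring_iso_memE(2-4)[OF j] jW gV' in
      \<open>auto simp: ghost_semiring_def V gW eV\<close>)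
  then have "is_cover R M v (V, \<lambda>a. h (\<phi> a))"
    using svV jv by (auto simp: is_cover_def em \<phi>W intro!: bexI[of _ "\<lambda>m. h (j m)"])
  moreover have "dominates R p (V, \<lambda>a. h (\<phi> a))" "dominates R (V, \<lambda>a. h (\<phi> a)) p"
    by (simp_all add: dominates_def p em \<phi>W sl Wm eW ij gV)
  ultimately show ?thesis by blast
qed

end

theory Submission
  imports Defs
begin

text \<open>Everything follows from the existence of suprema of arbitrary families of covers: the initial
  cover is the supremum of all covers, and a poset with arbitrary suprema is a complete lattice.

  The supremum of a family \<open>\<phi> i\<close> of covers with targets \<open>U i\<close> is the map \<open>a \<mapsto> (v a, (\<phi> i a)\<^sub>i)\<close> into
  the fibre product of \<open>M\<close> and the \<open>U i\<close> over \<open>M\<close>, where \<open>U i\<close> is mapped to \<open>M\<close> by the ghost map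
  \<open>u \<mapsto> eu\<close>. This fibre product is supertropical with ghost semiring \<open>M\<close>, because in each \<open>U i\<close> the sum
  of two elements depends only on the points of \<open>M\<close> below them: over different points the element
  over the larger one wins, over the same point the sum is the ghost of that point
  (\<open>supertropical_P\<close>, \<open>diag_identification\<close>). Two elements of \<open>R\<close> have the same image in the fibre
  product if and only if they do under every \<open>\<phi> i\<close> and under \<open>v\<close>, and an image is ghost if and only
  if all its coordinates are (\<open>exists_supremum_cover\<close>). Dominance between covers of the same \<open>v\<close> only
  depends on kernels and on the preimages of the ghosts (\<open>cover_dominates_iff\<close>), so this is the least
  upper bound.

  The fibre product over all covers lives in a function type; \<open>cover_equiv_sum_type\<close> moves it back to
  the type \<open>'r + 'm\<close>.\<close>

section \<open>Fibres of the ghost map\<close>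

locale ghost_identification = M?: bipotent_semiring M + U?: supertropical_semiring U
  for M :: "('m, 'b) ring_scheme" (structure) and U :: "('u, 'c) ring_scheme" (structure) +
  fixes j :: "'m \<Rightarrow> 'u"
  assumes iso: "j \<in> ring_iso M (ghost_semiring U)"
begin

lemma bij_ghosts: "bij_betw j (carrier M) (ghosts U)"
  using ring_iso_memE(5)[OF iso] by (simp add: ghost_semiring_def)

lemma j_ghost [simp]: "m \<in> carrier M \<Longrightarrow> j m \<in> ghosts U"
  using bij_ghosts by (auto simp: bij_betw_def)

lemma j_closed [simp]: "m \<in> carrier M \<Longrightarrow> j m \<in> carrier U"
  by (simp add: U.ghosts_closed)

lemma j_eq_iff: "\<lbrakk>m \<in> carrier M; n \<in> carrier M\<rbrakk> \<Longrightarrow> j m = j n \<longleftrightarrow> m = n"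
  using bij_ghosts by (auto simp: bij_betw_def inj_on_eq_iff)

lemma j_add: "\<lbrakk>m \<in> carrier M; n \<in> carrier M\<rbrakk> \<Longrightarrow> j (m \<oplus>\<^bsub>M\<^esub> n) = j m \<oplus>\<^bsub>U\<^esub> j n"
  using ring_iso_memE(3)[OF iso] by (simp add: ghost_semiring_def)

lemma j_mult: "\<lbrakk>m \<in> carrier M; n \<in> carrier M\<rbrakk> \<Longrightarrow> j (m \<otimes>\<^bsub>M\<^esub> n) = j m \<otimes>\<^bsub>U\<^esub> j n"
  using ring_iso_memE(2)[OF iso] by (simp add: ghost_semiring_def)

lemma j_one: "j \<one>\<^bsub>M\<^esub> = \<e>\<^bsub>U\<^esub>"
  using ring_iso_memE(4)[OF iso] by (simp add: ghost_semiring_def)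

text \<open>A ring isomorphism is only required to respect sums, products and units; since there is no
  subtraction, that it respects zero comes from surjectivity: some \<open>j m\<close> is zero, and
  \<open>j \<zero> \<oplus> j m = j m\<close>.\<close>

lemma j_zero: "j \<zero>\<^bsub>M\<^esub> = \<zero>\<^bsub>U\<^esub>"
proof -
  have "\<zero>\<^bsub>U\<^esub> \<in> ghosts U" by (simp add: U.ghosts_iff)
  then obtain m where m: "m \<in> carrier M" "\<zero>\<^bsub>U\<^esub> = j m"
    using bij_ghosts by (auto simp: bij_betw_def)
  then have "j \<zero>\<^bsub>M\<^esub> \<oplus>\<^bsub>U\<^esub> \<zero>\<^bsub>U\<^esub> = \<zero>\<^bsub>U\<^esub>"
    using j_add[of "\<zero>\<^bsub>M\<^esub>" m] by simp
  then show ?thesis by simp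
qed

lemma j_sle_iff: "\<lbrakk>m \<in> carrier M; n \<in> carrier M\<rbrakk> \<Longrightarrow> j m \<preceq>\<^bsub>U\<^esub> j n \<longleftrightarrow> m \<preceq>\<^bsub>M\<^esub> n"
  by (simp add: sle_def j_add[symmetric] j_eq_iff)

text \<open>The fibre of the ghost map \<open>u \<mapsto> eu\<close> over a point of \<open>M\<close>. Its elements add up to the ghost of
  that point (\<open>over_add_same\<close>), and lose against those of any fibre over a larger point
  (\<open>over_add_less\<close>); so \<open>M\<close> alone decides which of the three possible values a sum has.\<close>

definition lies_over :: "'u \<Rightarrow> 'm \<Rightarrow> bool"
  where "lies_over u m \<longleftrightarrow> u \<in> carrier U \<and> m \<in> carrier M \<and> \<e>\<^bsub>U\<^esub> \<otimes>\<^bsub>U\<^esub> u = j m"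

lemma over_closed: "lies_over u m \<Longrightarrow> u \<in> carrier U"
  by (simp add: lies_over_def)

lemma over_base: "lies_over u m \<Longrightarrow> m \<in> carrier M"
  by (simp add: lies_over_def)

lemma over_double: "lies_over u m \<Longrightarrow> u \<oplus>\<^bsub>U\<^esub> u = j m"
  using U.e_mult[of u] by (simp add: lies_over_def)

lemma over_ghost: "m \<in> carrier M \<Longrightarrow> lies_over (j m) m"
  using j_ghost[of m] by (simp add: lies_over_def U.ghosts_iff)

lemma over_zero: "lies_over \<zero>\<^bsub>U\<^esub> \<zero>\<^bsub>M\<^esub>"
  by (simp add: lies_over_def j_zero)

lemma over_one: "lies_over \<one>\<^bsub>U\<^esub> \<one>\<^bsub>M\<^esub>"
  by (simp add: lies_over_def j_one)

lemma over_add: "\<lbrakk>lies_over u m; lies_over w n\<rbrakk> \<Longrightarrow> lies_over (u \<oplus>\<^bsub>U\<^esub> w) (m \<oplus>\<^bsub>M\<^esub> n)"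
  by (simp add: lies_over_def U.r_distr j_add)

lemma over_mult: "\<lbrakk>lies_over u m; lies_over w n\<rbrakk> \<Longrightarrow> lies_over (u \<otimes>\<^bsub>U\<^esub> w) (m \<otimes>\<^bsub>M\<^esub> n)"
  unfolding lies_over_def
  by (metis M.m_closed U.e_closed U.e_idem U.m_assoc U.m_closed U.m_lcomm j_mult)

lemma over_ghost_iff: "lies_over u m \<Longrightarrow> u \<in> ghosts U \<longleftrightarrow> u = j m"
  by (auto simp: lies_over_def U.ghosts_iff)

lemma over_add_same: "\<lbrakk>lies_over u m; lies_over w m\<rbrakk> \<Longrightarrow> u \<oplus>\<^bsub>U\<^esub> w = j m"
  using U.ghost_eq[of u w] by (simp add: over_double over_closed)

lemma over_add_less:
  assumes u: "lies_over u m" and w: "lies_over w n" and "m \<noteq> n" "m \<oplus>\<^bsub>M\<^esub> n = n"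
  shows "u \<oplus>\<^bsub>U\<^esub> w = w"
proof -
  have "j m \<noteq> j n"
    using assms by (simp add: j_eq_iff over_base)
  then have "u \<oplus>\<^bsub>U\<^esub> w \<in> {u, w}"
    using u w by (intro U.ghost_neq) (simp_all add: over_double over_closed)
  moreover have "lies_over (u \<oplus>\<^bsub>U\<^esub> w) n"
    using over_add[OF u w] assms by simp
  ultimately show ?thesis
    using u \<open>j m \<noteq> j n\<close> by (auto simp: lies_over_def)
qed

end


section \<open>Covers as liftings of the valuation\<close>

text \<open>A cover chooses, multiplicatively, a point \<open>\<phi> a\<close> of the fibre over each \<open>v a\<close>.\<close>

lemma is_cover_iff:
  assumes "m_valuation R M v"
  shows "is_cover R M v (U, \<phi>) \<longleftrightarrow> supervaluation R U \<phi> \<and>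
    (\<exists>j. ghost_identification M U j \<and>
      (\<forall>a\<in>carrier R. ghost_identification.lies_over M U j (\<phi> a) (v a)))"
proof -
  interpret m_valuation R M v by (rule assms)
  have v: "v a \<in> carrier M" if "a \<in> carrier R" for a
    using val_closed that by auto
  show ?thesis (is "?L \<longleftrightarrow> ?R")
  proof
    assume ?L
    then obtain j where sv: "supervaluation R U \<phi>" and j: "j \<in> ring_iso M (ghost_semiring U)"
      and jv: "\<And>a. a \<in> carrier R \<Longrightarrow> \<e>\<^bsub>U\<^esub> \<otimes>\<^bsub>U\<^esub> \<phi> a = j (v a)"
      by (auto simp: is_cover_def)
    interpret S: supervaluation R U \<phi> by (rule sv)
    have gi: "ghost_identification M U j"
      by (intro ghost_identification.intro ghost_identification_axioms.intro j
        M.bipotent_semiring_axioms S.U.supertropical_semiring_axioms)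
    then show ?R
      using sv v jv S.sv_closed
      by (auto intro!: exI[of _ j] simp: ghost_identification.lies_over_def[OF gi])
  next
    assume ?R
    then show ?L
      by (auto simp: is_cover_def ghost_identification.lies_over_def
        dest: ghost_identification.iso)
  qed
qed

text \<open>The subadditivity of a supervaluation only concerns ghosts, so a multiplicative lifting
  of \<open>v\<close> to \<open>U\<close> inherits it from \<open>v\<close>.\<close>

lemma is_coverI_lifting:
  fixes U :: "'u ring"
  assumes "m_valuation R M v" and gi: "ghost_identification M U j"
    and over: "\<And>a. a \<in> carrier R \<Longrightarrow> ghost_identification.lies_over M U j (\<phi> a) (v a)"
    and zero: "\<phi> \<zero>\<^bsub>R\<^esub> = \<zero>\<^bsub>U\<^esub>" and one: "\<phi> \<one>\<^bsub>R\<^esub> = \<one>\<^bsub>U\<^esub>"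
    and mult: "\<And>a b. \<lbrakk>a \<in> carrier R; b \<in> carrier R\<rbrakk> \<Longrightarrow> \<phi> (a \<otimes>\<^bsub>R\<^esub> b) = \<phi> a \<otimes>\<^bsub>U\<^esub> \<phi> b"
  shows "is_cover R M v (U, \<phi>)"
proof -
  interpret m_valuation R M v by (rule assms)
  interpret G: ghost_identification M U j by (rule gi)
  have v: "v a \<in> carrier M" if "a \<in> carrier R" for a
    using val_closed that by auto
  have e: "\<e>\<^bsub>U\<^esub> \<otimes>\<^bsub>U\<^esub> \<phi> a = j (v a)" if "a \<in> carrier R" for a
    using over[OF that] by (simp add: G.lies_over_def)
  have "supervaluation R U \<phi>"
  proof (intro supervaluation.intro supervaluation_axioms.intro R.csemiring_axioms
      G.U.supertropical_semiring_axioms zero one mult)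
    show "\<phi> \<in> carrier R \<rightarrow> carrier U"
      using over G.over_closed by auto
    show "\<e>\<^bsub>U\<^esub> \<otimes>\<^bsub>U\<^esub> \<phi> (a \<oplus>\<^bsub>R\<^esub> b) \<preceq>\<^bsub>U\<^esub> \<e>\<^bsub>U\<^esub> \<otimes>\<^bsub>U\<^esub> \<phi> a \<oplus>\<^bsub>U\<^esub> \<e>\<^bsub>U\<^esub> \<otimes>\<^bsub>U\<^esub> \<phi> b"
      if "a \<in> carrier R" "b \<in> carrier R" for a b
      using val_add[OF that] that by (simp add: e v G.j_add[symmetric] G.j_sle_iff)
  qed
  then show ?thesis
    unfolding is_cover_iff[OF assms(1)] using gi over by blast
qed

lemma cover_eq_imp_val_eq:
  assumes val: "m_valuation R M v" and "is_cover R M v (U, \<phi>)"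
    and "a \<in> carrier R" "b \<in> carrier R" "\<phi> a = \<phi> b"
  shows "v a = v b"
proof -
  obtain j where gi: "ghost_identification M U j"
    and over: "\<And>a. a \<in> carrier R \<Longrightarrow> ghost_identification.lies_over M U j (\<phi> a) (v a)"
    using assms(2) unfolding is_cover_iff[OF val] by auto
  interpret G: ghost_identification M U j by (rule gi)
  have "j (v a) = j (v b)"
    using over[OF assms(3)] over[OF assms(4)] assms(5) by (simp add: G.lies_over_def)
  then show ?thesis
    using over[OF assms(3)] over[OF assms(4)] by (simp add: G.j_eq_iff G.over_base)
qed

lemma cover_order_iff:
  assumes val: "m_valuation R M v" and "is_cover R M v (U, \<phi>)"
    and ab: "a \<in> carrier R" "b \<in> carrier R"
  shows "\<e>\<^bsub>U\<^esub> \<otimes>\<^bsub>U\<^esub> \<phi> a \<preceq>\<^bsub>U\<^esub> \<e>\<^bsub>U\<^esub> \<otimes>\<^bsub>U\<^esub> \<phi> b \<longleftrightarrow> v a \<preceq>\<^bsub>M\<^esub> v b"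
proof -
  obtain j where gi: "ghost_identification M U j"
    and over: "\<And>a. a \<in> carrier R \<Longrightarrow> ghost_identification.lies_over M U j (\<phi> a) (v a)"
    using assms(2) unfolding is_cover_iff[OF val] by auto
  interpret G: ghost_identification M U j by (rule gi)
  show ?thesis
    using over[OF ab(1)] over[OF ab(2)] by (simp add: G.lies_over_def G.j_sle_iff)
qed

text \<open>The order condition in dominance compares ghosts only, and the ghosts of two covers of \<open>v\<close> are both
  copies of \<open>M\<close>. Dominance between covers is therefore a matter of kernels and ghost loci.\<close>

lemma cover_dominates_iff:
  assumes val: "m_valuation R M v"
    and "is_cover R M v (U, \<phi>)" "is_cover R M v (V, \<psi>)"
  shows "dominates R (U, \<phi>) (V, \<psi>) \<longleftrightarrow>
    (\<forall>a\<in>carrier R. \<forall>b\<in>carrier R. \<phi> a = \<phi> b \<longrightarrow> \<psi> a = \<psi> b) \<and>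
    (\<forall>a\<in>carrier R. \<phi> a \<in> ghosts U \<longrightarrow> \<psi> a \<in> ghosts V)"
  using cover_order_iff[OF val assms(2)] cover_order_iff[OF val assms(3)]
  unfolding dominates_def by auto


section \<open>Fibre products over the ghost semiring\<close>

lemma restrict_eq_iff: "restrict f A = restrict g A \<longleftrightarrow> (\<forall>x\<in>A. f x = g x)"
  by (metis restrict_apply' restrict_ext)

text \<open>The factors are glued along their common ghost semiring, so that the sum of two elements is
  decided by the same comparison in \<open>M\<close> in every coordinate; a sum in the plain product of the
  \<open>U i\<close> may mix coordinates of both summands. The coordinate in \<open>M\<close> makes the empty fibre product
  \<open>M\<close> itself.\<close>

definition fibre_product ::
    "('m, 'b) ring_scheme \<Rightarrow> 'i set \<Rightarrow> ('i \<Rightarrow> 'u ring) \<Rightarrow> ('i \<Rightarrow> 'm \<Rightarrow> 'u) \<Rightarrow> ('m \<times> ('i \<Rightarrow> 'u)) ring"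
  where "fibre_product M I U j =
    \<lparr>carrier = {(m, x). m \<in> carrier M \<and> x \<in> extensional I \<and>
        (\<forall>i\<in>I. ghost_identification.lies_over M (U i) (j i) (x i) m)},
     mult = (\<lambda>(m, x) (n, y). (m \<otimes>\<^bsub>M\<^esub> n, \<lambda>i\<in>I. x i \<otimes>\<^bsub>U i\<^esub> y i)),
     one = (\<one>\<^bsub>M\<^esub>, \<lambda>i\<in>I. \<one>\<^bsub>U i\<^esub>),
     zero = (\<zero>\<^bsub>M\<^esub>, \<lambda>i\<in>I. \<zero>\<^bsub>U i\<^esub>),
     add = (\<lambda>(m, x) (n, y). (m \<oplus>\<^bsub>M\<^esub> n, \<lambda>i\<in>I. x i \<oplus>\<^bsub>U i\<^esub> y i))\<rparr>"

locale ghost_identification_family = bipotent_semiring M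
  for M :: "('m, 'b) ring_scheme" (structure) +
  fixes I :: "'i set" and U :: "'i \<Rightarrow> 'u ring" and j :: "'i \<Rightarrow> 'm \<Rightarrow> 'u"
  assumes fam: "i \<in> I \<Longrightarrow> ghost_identification M (U i) (j i)"
begin

abbreviation over :: "'i \<Rightarrow> 'u \<Rightarrow> 'm \<Rightarrow> bool"
  where "over i \<equiv> ghost_identification.lies_over M (U i) (j i)"

abbreviation P :: "('m \<times> ('i \<Rightarrow> 'u)) ring"
  where "P \<equiv> fibre_product M I U j"

abbreviation diag :: "'m \<Rightarrow> 'm \<times> ('i \<Rightarrow> 'u)"
  where "diag m \<equiv> (m, \<lambda>i\<in>I. j i m)"

lemma carrier_iff:
  "(m, x) \<in> carrier P \<longleftrightarrow> m \<in> carrier M \<and> x \<in> extensional I \<and> (\<forall>i\<in>I. over i (x i) m)"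
  by (simp add: fibre_product_def)

lemma P_simps [simp]:
  "(m, x) \<oplus>\<^bsub>P\<^esub> (n, y) = (m \<oplus> n, \<lambda>i\<in>I. x i \<oplus>\<^bsub>U i\<^esub> y i)"
  "(m, x) \<otimes>\<^bsub>P\<^esub> (n, y) = (m \<otimes> n, \<lambda>i\<in>I. x i \<otimes>\<^bsub>U i\<^esub> y i)"
  "\<zero>\<^bsub>P\<^esub> = (\<zero>, \<lambda>i\<in>I. \<zero>\<^bsub>U i\<^esub>)" "\<one>\<^bsub>P\<^esub> = (\<one>, \<lambda>i\<in>I. \<one>\<^bsub>U i\<^esub>)"
  by (simp_all add: fibre_product_def)

lemma supertropical_factor: "i \<in> I \<Longrightarrow> supertropical_semiring (U i)"
  using fam ghost_identification.axioms(2) by blast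

lemma csemiring_factor: "i \<in> I \<Longrightarrow> csemiring (U i)"
  using supertropical_factor supertropical_semiring.axioms(1) by blast

lemma coord_closed: "\<lbrakk>(m, x) \<in> carrier P; i \<in> I\<rbrakk> \<Longrightarrow> x i \<in> carrier (U i)"
  using ghost_identification.over_closed[OF fam] by (auto simp: carrier_iff)

lemma csemiring_P: "csemiring P"
proof (rule csemiringI)
  fix a b c assume "a \<in> carrier P" "b \<in> carrier P" "c \<in> carrier P"
  then obtain m x n y k z where abc: "a = (m, x)" "b = (n, y)" "c = (k, z)"
    and P: "(m, x) \<in> carrier P" "(n, y) \<in> carrier P" "(k, z) \<in> carrier P"
    by (metis surj_pair)
  have M: "m \<in> carrier M" "n \<in> carrier M" "k \<in> carrier M"
    using P by (simp_all add: carrier_iff)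
  have U: "(x i \<oplus>\<^bsub>U i\<^esub> y i) \<oplus>\<^bsub>U i\<^esub> z i = x i \<oplus>\<^bsub>U i\<^esub> (y i \<oplus>\<^bsub>U i\<^esub> z i)"
    "(x i \<otimes>\<^bsub>U i\<^esub> y i) \<otimes>\<^bsub>U i\<^esub> z i = x i \<otimes>\<^bsub>U i\<^esub> (y i \<otimes>\<^bsub>U i\<^esub> z i)"
    "(x i \<oplus>\<^bsub>U i\<^esub> y i) \<otimes>\<^bsub>U i\<^esub> z i = x i \<otimes>\<^bsub>U i\<^esub> z i \<oplus>\<^bsub>U i\<^esub> y i \<otimes>\<^bsub>U i\<^esub> z i" if i: "i \<in> I" for i
  proof -
    interpret Ui: csemiring "U i" by (rule csemiring_factor[OF i])
    note closed = coord_closed[OF P(1) i] coord_closed[OF P(2) i] coord_closed[OF P(3) i]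
    show "(x i \<oplus>\<^bsub>U i\<^esub> y i) \<oplus>\<^bsub>U i\<^esub> z i = x i \<oplus>\<^bsub>U i\<^esub> (y i \<oplus>\<^bsub>U i\<^esub> z i)"
      using closed by (rule Ui.a_assoc)
    show "(x i \<otimes>\<^bsub>U i\<^esub> y i) \<otimes>\<^bsub>U i\<^esub> z i = x i \<otimes>\<^bsub>U i\<^esub> (y i \<otimes>\<^bsub>U i\<^esub> z i)"
      using closed by (rule Ui.m_assoc)
    show "(x i \<oplus>\<^bsub>U i\<^esub> y i) \<otimes>\<^bsub>U i\<^esub> z i = x i \<otimes>\<^bsub>U i\<^esub> z i \<oplus>\<^bsub>U i\<^esub> y i \<otimes>\<^bsub>U i\<^esub> z i"
      using closed by (rule Ui.l_distr)
  qed
  show "(a \<oplus>\<^bsub>P\<^esub> b) \<oplus>\<^bsub>P\<^esub> c = a \<oplus>\<^bsub>P\<^esub> (b \<oplus>\<^bsub>P\<^esub> c)"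
    unfolding abc using a_assoc[OF M] U(1) by (simp add: restrict_eq_iff)
  show "(a \<otimes>\<^bsub>P\<^esub> b) \<otimes>\<^bsub>P\<^esub> c = a \<otimes>\<^bsub>P\<^esub> (b \<otimes>\<^bsub>P\<^esub> c)"
    unfolding abc using m_assoc[OF M] U(2) by (simp add: restrict_eq_iff)
  show "(a \<oplus>\<^bsub>P\<^esub> b) \<otimes>\<^bsub>P\<^esub> c = a \<otimes>\<^bsub>P\<^esub> c \<oplus>\<^bsub>P\<^esub> b \<otimes>\<^bsub>P\<^esub> c"
    unfolding abc using l_distr[OF M] U(3) by (simp add: restrict_eq_iff)
next
  fix a b assume "a \<in> carrier P" "b \<in> carrier P"
  then obtain m x n y where ab: "a = (m, x)" "b = (n, y)"
    and P: "(m, x) \<in> carrier P" "(n, y) \<in> carrier P"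
    by (metis surj_pair)
  have M: "m \<in> carrier M" "n \<in> carrier M"
    using P by (simp_all add: carrier_iff)
  show "a \<oplus>\<^bsub>P\<^esub> b \<in> carrier P" "a \<otimes>\<^bsub>P\<^esub> b \<in> carrier P"
    using P unfolding ab
    by (simp_all add: carrier_iff ghost_identification.over_add[OF fam]
      ghost_identification.over_mult[OF fam])
  have U: "x i \<oplus>\<^bsub>U i\<^esub> y i = y i \<oplus>\<^bsub>U i\<^esub> x i" "x i \<otimes>\<^bsub>U i\<^esub> y i = y i \<otimes>\<^bsub>U i\<^esub> x i" if i: "i \<in> I" for i
  proof -
    interpret Ui: csemiring "U i" by (rule csemiring_factor[OF i])
    note closed = coord_closed[OF P(1) i] coord_closed[OF P(2) i]
    show "x i \<oplus>\<^bsub>U i\<^esub> y i = y i \<oplus>\<^bsub>U i\<^esub> x i"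
      using closed by (rule Ui.a_comm)
    show "x i \<otimes>\<^bsub>U i\<^esub> y i = y i \<otimes>\<^bsub>U i\<^esub> x i"
      using closed by (rule Ui.m_comm)
  qed
  show "a \<oplus>\<^bsub>P\<^esub> b = b \<oplus>\<^bsub>P\<^esub> a"
    unfolding ab using a_comm[OF M] U(1) by (simp add: restrict_eq_iff)
  show "a \<otimes>\<^bsub>P\<^esub> b = b \<otimes>\<^bsub>P\<^esub> a"
    unfolding ab using m_comm[OF M] U(2) by (simp add: restrict_eq_iff)
next
  fix a assume "a \<in> carrier P"
  then obtain m x where a: "a = (m, x)" and P: "(m, x) \<in> carrier P"
    by (metis surj_pair)
  have M: "m \<in> carrier M" and ext: "x = restrict x I"
    using P by (simp_all add: carrier_iff extensional_restrict)
  have U: "\<zero>\<^bsub>U i\<^esub> \<oplus>\<^bsub>U i\<^esub> x i = x i" "\<one>\<^bsub>U i\<^esub> \<otimes>\<^bsub>U i\<^esub> x i = x i" "\<zero>\<^bsub>U i\<^esub> \<otimes>\<^bsub>U i\<^esub> x i = \<zero>\<^bsub>U i\<^esub>"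
    if i: "i \<in> I" for i
  proof -
    interpret Ui: csemiring "U i" by (rule csemiring_factor[OF i])
    show "\<zero>\<^bsub>U i\<^esub> \<oplus>\<^bsub>U i\<^esub> x i = x i" "\<one>\<^bsub>U i\<^esub> \<otimes>\<^bsub>U i\<^esub> x i = x i" "\<zero>\<^bsub>U i\<^esub> \<otimes>\<^bsub>U i\<^esub> x i = \<zero>\<^bsub>U i\<^esub>"
      using coord_closed[OF P i] by simp_all
  qed
  show "\<zero>\<^bsub>P\<^esub> \<oplus>\<^bsub>P\<^esub> a = a"
    unfolding a by (subst (2) ext) (simp add: M U(1) restrict_eq_iff)
  show "\<one>\<^bsub>P\<^esub> \<otimes>\<^bsub>P\<^esub> a = a"
    unfolding a by (subst (2) ext) (simp add: M U(2) restrict_eq_iff)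
  show "\<zero>\<^bsub>P\<^esub> \<otimes>\<^bsub>P\<^esub> a = \<zero>\<^bsub>P\<^esub>"
    unfolding a by (simp add: M U(3) restrict_eq_iff)
qed (simp_all add: carrier_iff ghost_identification.over_zero[OF fam]
    ghost_identification.over_one[OF fam])

lemma add_idem: "m \<in> carrier M \<Longrightarrow> m \<oplus> m = m"
  using bipotent[of m m] by simp

text \<open>Elements over the same \<open>m\<close> add up to the ghost of \<open>m\<close>, and of two elements over different
  points the one over the larger point is the sum, uniformly in all coordinates.\<close>

lemma P_add_same: "\<lbrakk>(m, x) \<in> carrier P; (m, y) \<in> carrier P\<rbrakk> \<Longrightarrow> (m, x) \<oplus>\<^bsub>P\<^esub> (m, y) = diag m"
  by (auto intro!: restrict_ext simp: carrier_iff add_idem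
    ghost_identification.over_add_same[OF fam])

lemma P_add_less:
  assumes "(m, x) \<in> carrier P" "(n, y) \<in> carrier P" "m \<noteq> n" "m \<oplus> n = n"
  shows "(m, x) \<oplus>\<^bsub>P\<^esub> (n, y) = (n, y)"
proof -
  have "x i \<oplus>\<^bsub>U i\<^esub> y i = y i" if "i \<in> I" for i
    using assms that by (intro ghost_identification.over_add_less[OF fam[OF that], of _ m _ n])
      (auto simp: carrier_iff)
  then show ?thesis
    using assms by (auto intro!: extensionalityI[of _ I] simp: carrier_iff)
qed

lemma supertropical_P: "supertropical_semiring P"
proof -
  interpret P: csemiring P by (rule csemiring_P)
  show ?thesis
  proof (intro supertropical_semiring.intro supertropical_semiring_axioms.intro csemiring_P)
    show "\<one>\<^bsub>P\<^esub> \<oplus>\<^bsub>P\<^esub> \<one>\<^bsub>P\<^esub> = \<one>\<^bsub>P\<^esub> \<oplus>\<^bsub>P\<^esub> \<one>\<^bsub>P\<^esub> \<oplus>\<^bsub>P\<^esub> \<one>\<^bsub>P\<^esub> \<oplus>\<^bsub>P\<^esub> \<one>\<^bsub>P\<^esub>"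
      by (auto intro!: restrict_ext supertropical_semiring.one_four[OF supertropical_factor]
        simp: add_idem)
  next
    fix a b assume ab: "a \<in> carrier P" "b \<in> carrier P"
    obtain m x n y where eqs: "a = (m, x)" "b = (n, y)"
      by (metis surj_pair)
    have c: "(m, x) \<in> carrier P" "(n, y) \<in> carrier P" "m \<in> carrier M" "n \<in> carrier M"
      using ab unfolding eqs by (auto simp: carrier_iff)
    have double: "a \<oplus>\<^bsub>P\<^esub> a = diag m" "b \<oplus>\<^bsub>P\<^esub> b = diag n"
      unfolding eqs using P_add_same c by blast+
    {
      assume "a \<oplus>\<^bsub>P\<^esub> a = b \<oplus>\<^bsub>P\<^esub> b"
      then have "m = n" using double by simp
      then show "a \<oplus>\<^bsub>P\<^esub> b = a \<oplus>\<^bsub>P\<^esub> a"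
        using P_add_same[of m x y] c double(1) eqs by simp
    next
      assume "a \<oplus>\<^bsub>P\<^esub> a \<noteq> b \<oplus>\<^bsub>P\<^esub> b"
      then have "m \<noteq> n" using double by auto
      moreover have "m \<oplus> n = n \<or> n \<oplus> m = m"
        using bipotent[OF c(3,4)] a_comm[OF c(3,4)] by auto
      ultimately have "a \<oplus>\<^bsub>P\<^esub> b = b \<or> b \<oplus>\<^bsub>P\<^esub> a = a"
        unfolding eqs using P_add_less[OF c(1,2)] P_add_less[OF c(2,1)] by blast
      then show "a \<oplus>\<^bsub>P\<^esub> b \<in> {a, b}"
        unfolding P.a_comm[OF ab(2,1)] by blast
    }
  qed
qed

lemma diag_carrier: "m \<in> carrier M \<Longrightarrow> diag m \<in> carrier P"
  by (simp add: carrier_iff ghost_identification.over_ghost[OF fam])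

lemma e_mult_P: "(m, x) \<in> carrier P \<Longrightarrow> \<e>\<^bsub>P\<^esub> \<otimes>\<^bsub>P\<^esub> (m, x) = diag m"
  by (simp only: supertropical_semiring.e_mult[OF supertropical_P] P_add_same)

lemma ghosts_P: "ghosts P = diag ` carrier M"
proof
  show "ghosts P \<subseteq> diag ` carrier M"
  proof
    fix g assume "g \<in> ghosts P"
    then obtain m x where "(m, x) \<in> carrier P" "g = \<e>\<^bsub>P\<^esub> \<otimes>\<^bsub>P\<^esub> (m, x)"
      unfolding ghosts_def by auto
    then show "g \<in> diag ` carrier M"
      using e_mult_P carrier_iff by auto
  qed
  show "diag ` carrier M \<subseteq> ghosts P"
  proof
    fix g assume "g \<in> diag ` carrier M"
    then obtain m where m: "m \<in> carrier M" "g = diag m" by blast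
    show "g \<in> ghosts P"
      using imageI[OF diag_carrier[OF m(1)], of "(\<otimes>\<^bsub>P\<^esub>) \<e>\<^bsub>P\<^esub>"]
      unfolding ghosts_def m(2) e_mult_P[OF diag_carrier[OF m(1)]] .
  qed
qed

lemma diag_identification: "ghost_identification M P diag"
proof (intro ghost_identification.intro ghost_identification_axioms.intro
    bipotent_semiring_axioms supertropical_P ring_iso_memI)
  have sum: "a \<oplus>\<^bsub>ghost_semiring P\<^esub> b = a \<oplus>\<^bsub>P\<^esub> b"
    and prod: "a \<otimes>\<^bsub>ghost_semiring P\<^esub> b = a \<otimes>\<^bsub>P\<^esub> b"
    and unit: "\<one>\<^bsub>ghost_semiring P\<^esub> = \<one>\<^bsub>P\<^esub> \<oplus>\<^bsub>P\<^esub> \<one>\<^bsub>P\<^esub>"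
    and carrier: "carrier (ghost_semiring P) = diag ` carrier M" for a b
    by (simp_all add: ghost_semiring_def ghost_unit_def ghosts_P del: P_simps)
  show "bij_betw diag (carrier M) (carrier (ghost_semiring P))"
    by (simp add: carrier bij_betw_def inj_on_def)
  show "diag \<one> = \<one>\<^bsub>ghost_semiring P\<^esub>"
  proof -
    have "(\<one>, \<lambda>i\<in>I. \<one>\<^bsub>U i\<^esub>) \<in> carrier P"
      by (simp add: carrier_iff ghost_identification.over_one[OF fam])
    then show ?thesis
      unfolding unit P_simps(4) by (intro P_add_same[symmetric])
  qed
  show "diag m \<in> carrier (ghost_semiring P)" if "m \<in> carrier M" for m
    using that by (simp add: carrier)
  fix m n assume "m \<in> carrier M" "n \<in> carrier M"
  then show "diag (m \<otimes> n) = diag m \<otimes>\<^bsub>ghost_semiring P\<^esub> diag n"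
    "diag (m \<oplus> n) = diag m \<oplus>\<^bsub>ghost_semiring P\<^esub> diag n"
    by (simp_all add: sum prod restrict_eq_iff
      ghost_identification.j_mult[OF fam] ghost_identification.j_add[OF fam])
qed

lemma lies_over_P: "(m, x) \<in> carrier P \<Longrightarrow> ghost_identification.lies_over M P diag (m, x) m"
  unfolding ghost_identification.lies_over_def[OF diag_identification]
  by (intro conjI e_mult_P) (simp_all add: carrier_iff)

end


section \<open>Suprema of covers\<close>

text \<open>The kernel condition includes \<open>v a = v b\<close> for the sake of the empty family, whose supremum is \<open>v\<close>
  itself as a map into \<open>M\<close>.\<close>

lemma exists_supremum_cover:
  fixes R :: "('r, 'a) ring_scheme" and M :: "('m, 'b) ring_scheme"
    and U :: "'i \<Rightarrow> 'u ring" and \<phi> :: "'i \<Rightarrow> 'r \<Rightarrow> 'u"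
  assumes val: "m_valuation R M v"
    and cov: "\<And>i. i \<in> I \<Longrightarrow> is_cover R M v (U i, \<phi> i)"
  obtains V :: "('m \<times> ('i \<Rightarrow> 'u)) ring" and \<psi> where
    "is_cover R M v (V, \<psi>)"
    "\<And>a b. \<psi> a = \<psi> b \<longleftrightarrow> v a = v b \<and> (\<forall>i\<in>I. \<phi> i a = \<phi> i b)"
    "\<And>a. a \<in> carrier R \<Longrightarrow> \<psi> a \<in> ghosts V \<longleftrightarrow> (\<forall>i\<in>I. \<phi> i a \<in> ghosts (U i))"
proof -
  interpret m_valuation R M v by (rule val)
  obtain j where gi: "\<And>i. i \<in> I \<Longrightarrow> ghost_identification M (U i) (j i)"
    and over: "\<And>i a. \<lbrakk>i \<in> I; a \<in> carrier R\<rbrakk> \<Longrightarrow>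
      ghost_identification.lies_over M (U i) (j i) (\<phi> i a) (v a)"
    using cov unfolding is_cover_iff[OF val] by metis
  have sv: "supervaluation R (U i) (\<phi> i)" if "i \<in> I" for i
    using cov[OF that] by (simp add: is_cover_def)
  interpret F: ghost_identification_family M I U j
    by (intro ghost_identification_family.intro ghost_identification_family_axioms.intro
      M.bipotent_semiring_axioms gi)
  define \<psi> where "\<psi> a = (v a, \<lambda>i\<in>I. \<phi> i a)" for a
  have \<psi>_carrier: "\<psi> a \<in> carrier F.P" if "a \<in> carrier R" for a
    using that over val_closed by (auto simp: \<psi>_def F.carrier_iff)
  have "is_cover R M v (F.P, \<psi>)"
  proof (rule is_coverI_lifting[OF val F.diag_identification])
    show "ghost_identification.lies_over M F.P F.diag (\<psi> a) (v a)" if "a \<in> carrier R" for a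
      using F.lies_over_P \<psi>_carrier[OF that] by (simp add: \<psi>_def)
  qed (auto intro!: restrict_ext simp: \<psi>_def val_zero val_one val_mult
      supervaluation.sv_zero[OF sv] supervaluation.sv_one[OF sv] supervaluation.sv_mult[OF sv])
  moreover have "\<psi> a = \<psi> b \<longleftrightarrow> v a = v b \<and> (\<forall>i\<in>I. \<phi> i a = \<phi> i b)" for a b
    by (auto simp: \<psi>_def restrict_eq_iff)
  moreover have "\<psi> a \<in> ghosts F.P \<longleftrightarrow> (\<forall>i\<in>I. \<phi> i a \<in> ghosts (U i))" if a: "a \<in> carrier R" for a
  proof -
    have "\<psi> a \<in> ghosts F.P \<longleftrightarrow> (\<forall>i\<in>I. \<phi> i a = j i (v a))"
      using val_closed a by (auto simp: F.ghosts_P \<psi>_def restrict_eq_iff)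
    then show ?thesis
      using ghost_identification.over_ghost_iff[OF gi over] a by blast
  qed
  ultimately show thesis by (rule that)
qed

lemma dominatesD:
  assumes "dominates R p q" "a \<in> carrier R"
  shows "\<lbrakk>b \<in> carrier R; snd p a = snd p b\<rbrakk> \<Longrightarrow> snd q a = snd q b"
    and "snd p a \<in> ghosts (fst p) \<Longrightarrow> snd q a \<in> ghosts (fst q)"
  using assms unfolding dominates_def case_prod_beta fst_conv snd_conv by blast+

lemma supremum_of_covers:
  fixes R :: "('r, 'a) ring_scheme" and M :: "('m, 'b) ring_scheme"
    and C :: "('r, 'r + 'm) sval set"
  assumes val: "m_valuation R M v" and cov: "\<And>p. p \<in> C \<Longrightarrow> is_cover R M v p"
  obtains s :: "('r, 'r + 'm) sval" where "is_cover R M v s"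
    "\<forall>p\<in>C. dominates R s p"
    "\<forall>q :: ('r, 'r + 'm) sval.
      is_cover R M v q \<longrightarrow> (\<forall>p\<in>C. dominates R q p) \<longrightarrow> dominates R q s"
proof -
  obtain V :: "('m \<times> (('r, 'r + 'm) sval \<Rightarrow> 'r + 'm)) ring" and \<psi>
    where V: "is_cover R M v (V, \<psi>)"
      and eq: "\<And>a b. \<psi> a = \<psi> b \<longleftrightarrow> v a = v b \<and> (\<forall>p\<in>C. snd p a = snd p b)"
      and gh: "\<And>a. a \<in> carrier R \<Longrightarrow> \<psi> a \<in> ghosts V \<longleftrightarrow> (\<forall>p\<in>C. snd p a \<in> ghosts (fst p))"
  proof (rule exists_supremum_cover[OF val, of C fst snd])
    show "is_cover R M v (fst p, snd p)" if "p \<in> C" for p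
      using cov[OF that] by simp
  qed (rule that)
  obtain s :: "('r, 'r + 'm) sval" where s: "is_cover R M v s"
    and s_V: "dominates R s (V, \<psi>)" and V_s: "dominates R (V, \<psi>) s"
    using cover_equiv_sum_type[OF V] by blast
  show thesis
  proof (rule that[OF s]; intro ballI allI impI)
    fix p assume p: "p \<in> C"
    obtain W \<chi> where W: "p = (W, \<chi>)" by (cases p)
    have "dominates R (V, \<psi>) p"
      unfolding W cover_dominates_iff[OF val V cov[OF p, unfolded W]]
    proof (intro conjI ballI impI)
      show "\<chi> a = \<chi> b" if "\<psi> a = \<psi> b" for a b
        using that[unfolded eq] p W by auto
      show "\<chi> a \<in> ghosts W" if "a \<in> carrier R" "\<psi> a \<in> ghosts V" for a
        using that(2)[unfolded gh[OF that(1)]] p W by auto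
    qed
    with s_V show "dominates R s p" by (rule dominates_trans)
  next
    fix q :: "('r, 'r + 'm) sval"
    assume q: "is_cover R M v q" and dom: "\<forall>p\<in>C. dominates R q p"
    obtain W \<chi> where W: "q = (W, \<chi>)" by (cases q)
    have "dominates R q (V, \<psi>)"
      unfolding W cover_dominates_iff[OF val q[unfolded W] V]
    proof (intro conjI ballI impI)
      fix a b assume ab: "a \<in> carrier R" "b \<in> carrier R" "\<chi> a = \<chi> b"
      have "snd p a = snd p b" if "p \<in> C" for p
        using dominatesD(1)[OF bspec[OF dom that] ab(1,2)] ab(3) by (simp add: W)
      then show "\<psi> a = \<psi> b"
        using cover_eq_imp_val_eq[OF val q[unfolded W] ab] eq by blast
    next
      fix a assume a: "a \<in> carrier R" "\<chi> a \<in> ghosts W"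
      have "snd p a \<in> ghosts (fst p)" if "p \<in> C" for p
        using dominatesD(2)[OF bspec[OF dom that] a(1)] a(2) by (simp add: W)
      then show "\<psi> a \<in> ghosts V" using gh a(1) by blast
    qed
    then show "dominates R q s" using V_s by (rule dominates_trans)
  qed
qed

text \<open>The supremum of the covers with target in \<open>'r + 'm\<close> dominates the covers with target in any other
  type \<open>'w\<close> as well, since each of them is equivalent to one of the former.\<close>

lemma exists_initial_cover:
  fixes R :: "('r, 'a) ring_scheme" and M :: "('m, 'b) ring_scheme"
  assumes val: "m_valuation R M v"
  obtains p :: "('r, 'r + 'm) sval" where
    "initial_cover TYPE('r + 'm) R M v p" "initial_cover TYPE('w) R M v p"
proof -
  obtain s :: "('r, 'r + 'm) sval" where s: "is_cover R M v s"
    and top: "\<forall>p\<in>{p :: ('r, 'r + 'm) sval. is_cover R M v p}. dominates R s p"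
    by (rule supremum_of_covers[OF val, of "{p. is_cover R M v p}"]) (blast, rule that)
  have "dominates R s q" if q: "is_cover R M v q" for q :: "('r, 'w) sval"
    using cover_equiv_sum_type[OF q] top dominates_trans by blast
  then show thesis
    using that[of s] s top unfolding initial_cover_def by blast
qed


section \<open>The lattice of covers\<close>

lemma Cov_cases:
  assumes "x \<in> carrier (Cov R M v)"
  obtains p where "is_cover R M v p" "x = cover_equiv R M v `` {p}"
  using assms by (auto simp: Cov_def elim!: quotientE)

lemma class_in_Cov: "is_cover R M v p \<Longrightarrow> cover_equiv R M v `` {p} \<in> carrier (Cov R M v)"
  by (auto simp: Cov_def intro: quotientI)

lemma partial_order_Cov: "partial_order (Cov R M v)"
proof -
  have eq: "eq (Cov R M v) = (=)" by (simp add: Cov_def)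
  show ?thesis
  proof
    fix x assume "x \<in> carrier (Cov R M v)"
    then show "x \<sqsubseteq>\<^bsub>Cov R M v\<^esub> x"
      by (elim Cov_cases) (simp add: Cov_le_iff dominates_refl)
  next
    fix x y
    assume le: "x \<sqsubseteq>\<^bsub>Cov R M v\<^esub> y" "y \<sqsubseteq>\<^bsub>Cov R M v\<^esub> x"
      and xy: "x \<in> carrier (Cov R M v)" "y \<in> carrier (Cov R M v)"
    obtain p q where p: "is_cover R M v p" "x = cover_equiv R M v `` {p}"
      and q: "is_cover R M v q" "y = cover_equiv R M v `` {q}"
      using xy by (elim Cov_cases)
    have "dominates R q p" "dominates R p q"
      using le unfolding p(2) q(2) by (simp_all only: Cov_le_iff p(1) q(1))
    then have "(p, q) \<in> cover_equiv R M v"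
      using p(1) q(1) by (simp add: cover_equiv_def)
    then show "x .=\<^bsub>Cov R M v\<^esub> y"
      unfolding eq p q by (rule equiv_class_eq[OF equiv_cover_equiv])
  next
    fix x y z
    assume le: "x \<sqsubseteq>\<^bsub>Cov R M v\<^esub> y" "y \<sqsubseteq>\<^bsub>Cov R M v\<^esub> z"
      and xyz: "x \<in> carrier (Cov R M v)" "y \<in> carrier (Cov R M v)" "z \<in> carrier (Cov R M v)"
    show "x \<sqsubseteq>\<^bsub>Cov R M v\<^esub> z"
      using xyz le by (elim Cov_cases) (auto simp: Cov_le_iff intro: dominates_trans)
  qed (simp_all add: eq)
qed

lemma Cov_sup_exists:
  fixes R :: "('r, 'a) ring_scheme" and M :: "('m, 'b) ring_scheme"
  assumes val: "m_valuation R M v" and A: "A \<subseteq> carrier (Cov R M v)"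
  shows "\<exists>s. least (Cov R M v) s (Upper (Cov R M v) A)"
proof -
  define C :: "('r, 'r + 'm) sval set"
    where "C = {p. is_cover R M v p \<and> cover_equiv R M v `` {p} \<in> A}"
  obtain s :: "('r, 'r + 'm) sval" where s: "is_cover R M v s"
    and upper: "\<forall>p\<in>C. dominates R s p"
    and least: "\<forall>q :: ('r, 'r + 'm) sval.
      is_cover R M v q \<longrightarrow> (\<forall>p\<in>C. dominates R q p) \<longrightarrow> dominates R q s"
  proof (rule supremum_of_covers[OF val])
    show "is_cover R M v p" if "p \<in> C" for p
      using that by (simp add: C_def)
  qed (rule that)
  have "least (Cov R M v) (cover_equiv R M v `` {s}) (Upper (Cov R M v) A)"
  proof (rule least_UpperI[OF _ _ A class_in_Cov[OF s]])
    fix x assume x: "x \<in> A"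
    then obtain p where "is_cover R M v p" "x = cover_equiv R M v `` {p}"
      using A by (blast elim: Cov_cases)
    then show "x \<sqsubseteq>\<^bsub>Cov R M v\<^esub> cover_equiv R M v `` {s}"
      using x s bspec[OF upper, of p] by (simp add: Cov_le_iff C_def)
  next
    fix y assume y: "y \<in> Upper (Cov R M v) A"
    then obtain q where q: "is_cover R M v q" "y = cover_equiv R M v `` {q}"
      by (auto simp: Upper_def elim: Cov_cases)
    have upper_q: "dominates R q p" if "p \<in> C" for p
    proof -
      have "cover_equiv R M v `` {p} \<sqsubseteq>\<^bsub>Cov R M v\<^esub> y"
        using y A that by (auto simp: Upper_def C_def)
      then show ?thesis using that q by (simp add: C_def Cov_le_iff)
    qed
    have "dominates R q s"
      using least q(1) upper_q by blast
    then show "cover_equiv R M v `` {s} \<sqsubseteq>\<^bsub>Cov R M v\<^esub> y"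
      using q s by (simp add: Cov_le_iff)
  qed
  then show ?thesis ..
qed

text \<open>As in any poset with arbitrary suprema, the infimum of \<open>A\<close> is the supremum of the lower
  bounds of \<open>A\<close>.\<close>

lemma complete_lattice_Cov:
  assumes val: "m_valuation R M v"
  shows "complete_lattice (Cov R M v)"
proof -
  interpret partial_order "Cov R M v" by (rule partial_order_Cov)
  show ?thesis
  proof (rule complete_latticeI)
    fix A assume A: "A \<subseteq> carrier (Cov R M v)"
    show "\<exists>s. least (Cov R M v) s (Upper (Cov R M v) A)"
      using val A by (rule Cov_sup_exists)
    obtain i where i: "least (Cov R M v) i (Upper (Cov R M v) (Lower (Cov R M v) A))"
      using Cov_sup_exists[OF val Lower_closed] by blast
    have "greatest (Cov R M v) i (Lower (Cov R M v) A)"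
    proof (rule greatest_LowerI[OF _ _ A])
      show "i \<sqsubseteq>\<^bsub>Cov R M v\<^esub> x" if "x \<in> A" for x
        using i that A by (auto intro!: least_le[OF i] simp: Upper_def Lower_def)
      show "y \<sqsubseteq>\<^bsub>Cov R M v\<^esub> i" if "y \<in> Lower (Cov R M v) A" for y
        using least_Upper_above[OF i that] by simp
    qed (use i in auto)
    then show "\<exists>i. greatest (Cov R M v) i (Lower (Cov R M v) A)" ..
  qed
qed

theorem proposition7p5:
  fixes R :: "('r, 'a) ring_scheme" and M :: "('m, 'b) ring_scheme" and v :: "'r \<Rightarrow> 'm"
  assumes "csemiring R" and "m_valuation R M v"
  shows "(\<exists>p :: ('r, 'r + 'm) sval.
            initial_cover TYPE('r + 'm) R M v p \<and> initial_cover TYPE('w) R M v p)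
         \<and> complete_lattice (Cov R M v)"
proof -
  obtain p :: "('r, 'r + 'm) sval" where
    "initial_cover TYPE('r + 'm) R M v p" "initial_cover TYPE('w) R M v p"
    by (rule exists_initial_cover[OF assms(2)])
  then show ?thesis
    using complete_lattice_Cov[OF assms(2)] by blast
qed

end
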